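(* The property $\mathcal{D}^{\rm cyc}=\bigcup_{x^*\in\{0,1\}^n}\mathcal{D}^{\rm cyc}(x^* )$ can be tested in the DoHO model using $O(1/\epsilon)$ samples and $\widetilde{O}(\sqrt{n}/\epsilon)$ queries.
   Context: For $x^*\in\{0,1\}^n$, $\mathcal{D}^{\rm cyc}(x^* )$ is the set of distributions $X$ over $\{0,1\}^n$ for which there is a random variable $J\in\{0,1,\dots,n-1\}$ such that, for every $j$, with probability $\Pr[J=j]$ it holds that $X_i=x^*_{(i+j)_n}$ for all $i\in[n]$, where $(i+j)_n$ is $i+j$ if $i+j\le n$ and $i+j-n$ otherwise (i.e., $X$ is an arbitrarily distributed cyclic shift of $x^*$). For $x,y\in\{0,1\}^n$ let $\Delta_H(x,y)=\frac1n|\{i:x_i\neq y_i\}|$. The distance between distributions $P,Q$ over $\{0,1\}^n$ is $\min\sum_{x,y}w_{x,y}\Delta_H(x,y)$ over nonnegative $w_{x,y}$ with $\sum_y w_{x,y}=P(x)$, $\sum_x w_{x,y}=Q(y)$; $\epsilon$-far from a set means distance greater than $\epsilon$ to every member. A tester in the DoHO model for a set $\mathcal{E}$ of distributions over $\{0,1\}^n$ gets $n,\epsilon$ and oracle access to independent samples of an unknown distribution $P$, may query individual bits of samples, and must accept with probability at least $2/3$ if $P\in\mathcal{E}$ and reject with probability at least $2/3$ if $P$ is $\epsilon$-far from $\mathcal{E}$; its query complexity is the total number of bit queries. *)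

theory Defs
  imports "HOL-Probability.Probability"
begin

text \<open>Strings in $\{0,1\}^n$ are Boolean lists of length \<open>n\<close>, with positions \<open>0, \<dots>, n - 1\<close>.
  Distributions over $\{0,1\}^n$ are \<open>bool list pmf\<close>s supported on \<open>bitstrings n\<close>.\<close>

definition bitstrings :: "nat \<Rightarrow> bool list set" where
  "bitstrings n = {x. length x = n}"

definition hamming_dist :: "nat \<Rightarrow> bool list \<Rightarrow> bool list \<Rightarrow> real" where
  "hamming_dist n x y = real (card {i. i < n \<and> x ! i \<noteq> y ! i}) / real n"

definition transport_plan ::
    "nat \<Rightarrow> bool list pmf \<Rightarrow> bool list pmf \<Rightarrow> (bool list \<Rightarrow> bool list \<Rightarrow> real) \<Rightarrow> bool" where
  "transport_plan n P Q w \<longleftrightarrow>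
     (\<forall>x\<in>bitstrings n. \<forall>y\<in>bitstrings n. w x y \<ge> 0) \<and>
     (\<forall>x\<in>bitstrings n. (\<Sum>y\<in>bitstrings n. w x y) = pmf P x) \<and>
     (\<forall>y\<in>bitstrings n. (\<Sum>x\<in>bitstrings n. w x y) = pmf Q y)"

text \<open>The infimum is a minimum: the transport plans of two distributions over $\{0,1\}^n$, restricted
  to \<open>bitstrings n\<close>, form a nonempty compact polytope on which the cost is linear.\<close>

definition distr_dist :: "nat \<Rightarrow> bool list pmf \<Rightarrow> bool list pmf \<Rightarrow> real" where
  "distr_dist n P Q =
     (INF w\<in>{w. transport_plan n P Q w}.
        \<Sum>x\<in>bitstrings n. \<Sum>y\<in>bitstrings n. w x y * hamming_dist n x y)"

definition far_from :: "nat \<Rightarrow> real \<Rightarrow> bool list pmf \<Rightarrow> bool list pmf set \<Rightarrow> bool" where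
  "far_from n \<epsilon> P E \<longleftrightarrow> (\<forall>Q\<in>E. distr_dist n P Q > \<epsilon>)"

text \<open>With positions counted from \<open>0\<close>, the shifted index is \<open>(i + j) mod n\<close>, and
  \<open>rotate j x ! i = x ! ((j + i) mod n)\<close> for \<open>i < n = length x\<close>; see \<open>nth_rotate\<close>.\<close>

definition Dcyc_of :: "nat \<Rightarrow> bool list \<Rightarrow> bool list pmf set" where
  "Dcyc_of n xstar = {map_pmf (\<lambda>j. rotate j xstar) J | J :: nat pmf. set_pmf J \<subseteq> {0..<n}}"

definition Dcyc :: "nat \<Rightarrow> bool list pmf set" where
  "Dcyc n = (\<Union>xstar\<in>bitstrings n. Dcyc_of n xstar)"

text \<open>A deterministic adaptive algorithm with query access to a sequence of samples:
  \<open>Query k i t0 t1\<close> reads bit \<open>i\<close> of sample \<open>k\<close> and continues as \<open>t0\<close> if it is \<open>0\<close> and as \<open>t1\<close> if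
  it is \<open>1\<close>. A randomized algorithm is a distribution over such trees, i.e. its coins are tossed in
  advance; only samples and bit queries are charged for, not computation.\<close>

datatype query_tree = Verdict bool | Query nat nat query_tree query_tree

primrec accepts :: "(nat \<Rightarrow> bool list) \<Rightarrow> query_tree \<Rightarrow> bool" where
  "accepts \<sigma> (Verdict b) = b"
| "accepts \<sigma> (Query k i t0 t1) = (if \<sigma> k ! i then accepts \<sigma> t1 else accepts \<sigma> t0)"

primrec max_queries :: "query_tree \<Rightarrow> nat" where
  "max_queries (Verdict b) = 0"
| "max_queries (Query k i t0 t1) = Suc (max (max_queries t0) (max_queries t1))"

primrec legal_queries :: "nat \<Rightarrow> nat \<Rightarrow> query_tree \<Rightarrow> bool" where
  "legal_queries s n (Verdict b) = True"
| "legal_queries s n (Query k i t0 t1) =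
     (k < s \<and> i < n \<and> legal_queries s n t0 \<and> legal_queries s n t1)"

definition verdict_prob :: "nat \<Rightarrow> bool list pmf \<Rightarrow> query_tree pmf \<Rightarrow> bool \<Rightarrow> real" where
  "verdict_prob s P A b =
     measure_pmf.prob (pair_pmf A (Pi_pmf {..<s} [] (\<lambda>_. P))) {(t, \<sigma>). accepts \<sigma> t = b}"

definition DoHO_tester ::
    "(nat \<Rightarrow> bool list pmf set) \<Rightarrow> (nat \<Rightarrow> real \<Rightarrow> nat) \<Rightarrow> (nat \<Rightarrow> real \<Rightarrow> nat) \<Rightarrow>
     (nat \<Rightarrow> real \<Rightarrow> query_tree pmf) \<Rightarrow> bool" where
  "DoHO_tester E s q T \<longleftrightarrow>
     (\<forall>n \<epsilon>. n \<ge> 1 \<longrightarrow> 0 < \<epsilon> \<longrightarrow> \<epsilon> \<le> 1 \<longrightarrow>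
        (\<forall>t\<in>set_pmf (T n \<epsilon>). legal_queries (s n \<epsilon>) n t \<and> max_queries t \<le> q n \<epsilon>) \<and>
        (\<forall>P. set_pmf P \<subseteq> bitstrings n \<longrightarrow>
           (P \<in> E n \<longrightarrow> verdict_prob (s n \<epsilon>) P (T n \<epsilon>) True \<ge> 2 / 3) \<and>
           (far_from n \<epsilon> P (E n) \<longrightarrow> verdict_prob (s n \<epsilon>) P (T n \<epsilon>) False \<ge> 2 / 3)))"

text \<open>Bounds hold uniformly for all \<open>n \<ge> 1\<close> and \<open>0 < \<epsilon> \<le> 1\<close>. The soft-O convention is
  $\widetilde{O}(g) = O(g \cdot \mathrm{polylog}(g))$; the summand \<open>2\<close> keeps the logarithm above \<open>1\<close>.\<close>

definition big_O_bound :: "(nat \<Rightarrow> real \<Rightarrow> nat) \<Rightarrow> (nat \<Rightarrow> real \<Rightarrow> real) \<Rightarrow> bool" where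
  "big_O_bound f g \<longleftrightarrow>
     (\<exists>c. \<forall>n \<epsilon>. n \<ge> 1 \<longrightarrow> 0 < \<epsilon> \<longrightarrow> \<epsilon> \<le> 1 \<longrightarrow> real (f n \<epsilon>) \<le> c * g n \<epsilon>)"

definition soft_O_bound :: "(nat \<Rightarrow> real \<Rightarrow> nat) \<Rightarrow> (nat \<Rightarrow> real \<Rightarrow> real) \<Rightarrow> bool" where
  "soft_O_bound f g \<longleftrightarrow>
     (\<exists>k. big_O_bound f (\<lambda>n \<epsilon>. g n \<epsilon> * ln (2 + g n \<epsilon>) ^ k))"

end

theory Submission imports Defs begin

text \<open>Sample \<open>0\<close> serves as reference. Write \<open>d y\<close> for the distance of \<open>y\<close> to the closest cyclic
  shift of it. Moving every \<open>y\<close> to that shift transports \<open>P\<close> into \<open>Dcyc\<close>, so if \<open>P\<close> is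
  $\epsilon$-far then \<open>d\<close> has expectation more than $\epsilon$. The samples \<open>k = 1, \<dots>, s\<close>
  are tested with decreasing sensitivity: about \<open>(s / k) * ln n\<close> random positions suffice to refute
  all \<open>n\<close> shifts for sample \<open>k\<close> when its distance is at least \<open>k / s\<close>. The number of \<open>k\<close>
  for which this happens has expectation at least $s\epsilon - 1$, so with
  $s = O(1/\epsilon)$ such a \<open>k\<close> is likely to exist, while the harmonic sum over \<open>k\<close> costs only a
  logarithm. The verdict is acceptance iff the answers are consistent with some sequence of
  cyclic shifts of one string, which makes the error one-sided.\<close>

section \<open>Nonadaptive query trees with a consistency verdict\<close>

primrec nonadaptive_tree :: "(nat \<times> nat) list \<Rightarrow> (bool list \<Rightarrow> bool) \<Rightarrow> query_tree" where
  "nonadaptive_tree [] f = Verdict (f [])"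
| "nonadaptive_tree (p # ps) f = Query (fst p) (snd p)
     (nonadaptive_tree ps (\<lambda>bs. f (False # bs))) (nonadaptive_tree ps (\<lambda>bs. f (True # bs)))"

lemma accepts_nonadaptive_tree:
  "accepts \<sigma> (nonadaptive_tree ps f) = f (map (\<lambda>(k, i). \<sigma> k ! i) ps)"
  by (induction ps arbitrary: f) (auto split: prod.splits)

lemma max_queries_nonadaptive_tree: "max_queries (nonadaptive_tree ps f) = length ps"
  by (induction ps arbitrary: f) auto

lemma legal_queries_nonadaptive_tree:
  "legal_queries s n (nonadaptive_tree ps f) \<longleftrightarrow> (\<forall>(k, i)\<in>set ps. k < s \<and> i < n)"
  by (induction ps arbitrary: f) (auto split: prod.splits)

text \<open>The search over all sequences satisfying \<open>G\<close> costs no queries. If the true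
  samples satisfy \<open>G\<close>, they are themselves a witness, so only false acceptance can
  occur.\<close>

definition consistency_tree :: "(nat \<times> nat) list \<Rightarrow> ((nat \<Rightarrow> bool list) \<Rightarrow> bool) \<Rightarrow> query_tree" where
  "consistency_tree ps G =
     nonadaptive_tree ps (\<lambda>bs. \<exists>\<tau>. G \<tau> \<and> map (\<lambda>(k, i). \<tau> k ! i) ps = bs)"

lemma accepts_consistency_tree:
  "accepts \<sigma> (consistency_tree ps G) \<longleftrightarrow> (\<exists>\<tau>. G \<tau> \<and> (\<forall>(k, i)\<in>set ps. \<tau> k ! i = \<sigma> k ! i))"
  by (auto simp: consistency_tree_def accepts_nonadaptive_tree)

section \<open>The shift tester and its baby-step giant-step queries\<close>

definition all_shifts :: "nat \<Rightarrow> nat \<Rightarrow> (nat \<Rightarrow> bool list) \<Rightarrow> bool" where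
  "all_shifts n s \<tau> \<longleftrightarrow> length (\<tau> 0) = n \<and> (\<forall>k\<in>{1..s}. \<exists>j<n. \<tau> k = rotate j (\<tau> 0))"

text \<open>Baby steps \<open>a\<close> in the tested sample and giant steps \<open>b * g\<close> in the reference sample \<open>0\<close>:
  every shift \<open>j < n \<le> g\<^sup>2\<close> is a difference \<open>b * g - a\<close>, so these queries compare
  the two samples at one random position for every shift.\<close>

definition shift_probes :: "nat \<Rightarrow> nat \<Rightarrow> nat \<Rightarrow> nat \<Rightarrow> (nat \<times> nat) list" where
  "shift_probes n g k i =
     map (\<lambda>b. (0, (i + b * g) mod n)) [0..<Suc g] @ map (\<lambda>a. (k, (i + a) mod n)) [0..<g]"

definition probes :: "nat \<Rightarrow> nat \<Rightarrow> (nat \<Rightarrow> nat) \<Rightarrow> nat \<Rightarrow> (nat \<Rightarrow> nat) \<Rightarrow> (nat \<times> nat) list" where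
  "probes n g m s \<iota> =
     concat (map (\<lambda>k. concat (map (\<lambda>r. shift_probes n g k (\<iota> r)) [0..<m k])) [1..<Suc s])"

text \<open>All samples share one pool of offsets, sample \<open>k\<close> using the first
  \<open>m k\<close> of them. Soundness looks at a single \<open>k\<close>, so independence within
  the pool suffices; the sum taken as pool size in \<open>shift_tester\<close> is a convenient bound
  on every \<open>m k\<close>.\<close>

definition offset_pmf :: "nat \<Rightarrow> nat \<Rightarrow> (nat \<Rightarrow> nat) pmf" where
  "offset_pmf n M = Pi_pmf {..<M} 0 (\<lambda>_. pmf_of_set {..<n})"

definition shift_tester :: "nat \<Rightarrow> nat \<Rightarrow> (nat \<Rightarrow> nat) \<Rightarrow> nat \<Rightarrow> query_tree pmf" where
  "shift_tester n g m s =
     map_pmf (\<lambda>\<iota>. consistency_tree (probes n g m s \<iota>) (all_shifts n s))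
       (offset_pmf n (\<Sum>k=1..s. m k))"

lemma set_probes:
  "set (probes n g m s \<iota>) =
     (\<Union>k\<in>{1..s}. \<Union>r\<in>{..<m k}.
        (\<lambda>b. (0, (\<iota> r + b * g) mod n)) ` {..g} \<union> (\<lambda>a. (k, (\<iota> r + a) mod n)) ` {..<g})"
  unfolding probes_def shift_probes_def
  by (simp add: atLeastLessThanSuc_atLeastAtMost lessThan_atLeast0 atMost_atLeast0 del: upt_Suc)

lemma shift_probes_in_probes:
  assumes "k \<in> {1..s}" "r < m k"
  shows "b \<le> g \<Longrightarrow> (0, (\<iota> r + b * g) mod n) \<in> set (probes n g m s \<iota>)"
    "a < g \<Longrightarrow> (k, (\<iota> r + a) mod n) \<in> set (probes n g m s \<iota>)"
  unfolding set_probes by (rule UN_I[OF assms(1)], rule UN_I[of r]; use assms in simp)+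

lemma length_probes: "length (probes n g m s \<iota>) = (\<Sum>k=1..s. m k) * (2 * g + 1)"
  by (simp add: probes_def shift_probes_def length_concat o_def sum_list_triv
      interv_sum_list_conv_sum_set_nat atLeastLessThanSuc_atLeastAtMost
      sum_distrib_right del: upt_Suc) (simp add: mult_2 sum.distrib)

lemma shift_tester_legal:
  assumes "t \<in> set_pmf (shift_tester n g m s)" "n \<ge> 1"
  shows "legal_queries (Suc s) n t" "max_queries t = (\<Sum>k=1..s. m k) * (2 * g + 1)"
  using assms
  by (auto simp: shift_tester_def consistency_tree_def legal_queries_nonadaptive_tree set_probes
      max_queries_nonadaptive_tree length_probes)

lemma accepts_shift_tester:
  assumes "t \<in> set_pmf (shift_tester n g m s)" "all_shifts n s \<sigma>"
  shows "accepts \<sigma> t"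
  using assms by (auto simp: shift_tester_def accepts_consistency_tree)

text \<open>Take \<open>b\<close> as \<open>j / g\<close> rounded up. Since
  \<open>j < g * g\<close>, this can reach \<open>b = g\<close>, which is why
  \<open>shift_probes\<close> makes \<open>g + 1\<close> giant steps but only \<open>g\<close> baby
  steps.\<close>

lemma giant_step_baby_step:
  assumes "j < n" "n \<le> g * g"
  obtains a b where "a < g" "b \<le> g" "b * g = j + (a :: nat)"
proof -
  have g: "g > 0" using assms by (cases g) auto
  define b where "b = (j + g - 1) div g"
  have "j + g - 1 = b * g + (j + g - 1) mod g" by (simp add: b_def)
  moreover have "(j + g - 1) mod g < g" using g by simp
  ultimately have b: "j \<le> b * g" "b * g < j + g" using g by linarith+
  have "b * g < Suc g * g" using b assms by simp
  hence "b < Suc g" using mult_less_cancel2 by blast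
  thus ?thesis using b that[of "b * g - j" b] by auto
qed

text \<open>Acceptance is witnessed by some \<open>\<tau>\<close> that agrees with
  \<open>\<sigma>\<close> on the probes only. The shift \<open>j\<close> relating
  \<open>\<tau> k\<close> to \<open>\<tau> 0\<close> is still visible in \<open>\<sigma>\<close>:
  position \<open>\<iota> r + a j\<close> of sample \<open>k\<close> and its partner
  \<open>\<iota> r + b * g\<close> of sample \<open>0\<close>, \<open>j\<close> places further, are
  both probed.\<close>

lemma all_shifts_accepted_agreement:
  assumes acc: "accepts \<sigma> (consistency_tree (probes n g m s \<iota>) (all_shifts n s))"
    and k: "k \<in> {1..s}" and steps: "\<And>j. j < n \<Longrightarrow> a j < g \<and> (\<exists>b\<le>g. b * g = j + a j)"
  obtains j where "j < n" "\<And>r. r < m k \<Longrightarrow>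
    \<sigma> k ! ((\<iota> r + a j) mod n) = \<sigma> 0 ! (((\<iota> r + a j) mod n + j) mod n)"
proof -
  obtain \<tau> where \<tau>: "all_shifts n s \<tau>" "\<And>l i. (l, i) \<in> set (probes n g m s \<iota>) \<Longrightarrow> \<tau> l ! i = \<sigma> l ! i"
    using acc by (auto simp: accepts_consistency_tree)
  then obtain j where j: "j < n" "\<tau> k = rotate j (\<tau> 0)" and len: "length (\<tau> 0) = n"
    using k by (metis all_shifts_def)
  obtain b where ab: "a j < g" "b \<le> g" "b * g = j + a j"
    using steps[OF j(1)] by blast
  show ?thesis
  proof (rule that[OF j(1)])
    fix r assume r: "r < m k"
    have "\<sigma> k ! ((\<iota> r + a j) mod n) = \<tau> k ! ((\<iota> r + a j) mod n)"
      by (intro \<tau>(2)[symmetric] shift_probes_in_probes[where k = k and m = m] k r ab)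
    also have "\<dots> = \<tau> 0 ! ((j + (\<iota> r + a j) mod n) mod n)"
      using j len by (simp add: nth_rotate)
    also have "(j + (\<iota> r + a j) mod n) mod n = (\<iota> r + b * g) mod n"
      by (simp only: ab(3) mod_add_right_eq) (simp only: add_ac)
    also have "\<tau> 0 ! \<dots> = \<sigma> 0 ! \<dots>"
      by (intro \<tau>(2) shift_probes_in_probes[where k = k and m = m] k r ab)
    also have "(\<iota> r + b * g) mod n = ((\<iota> r + a j) mod n + j) mod n"
      by (simp only: ab(3) mod_add_left_eq) (simp only: add_ac)
    finally show "\<sigma> k ! ((\<iota> r + a j) mod n) = \<sigma> 0 ! (((\<iota> r + a j) mod n + j) mod n)" .
  qed
qed

section \<open>Distance to the closest cyclic shift\<close>

definition shift_dist :: "nat \<Rightarrow> bool list \<Rightarrow> bool list \<Rightarrow> real" where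
  "shift_dist n x y = (MIN j\<in>{..<n}. hamming_dist n y (rotate j x))"

lemma hamming_dist_nonneg: "hamming_dist n x y \<ge> 0"
  by (simp add: hamming_dist_def)

lemma hamming_dist_le_1: "hamming_dist n x y \<le> 1"
proof -
  have "card {i. i < n \<and> x ! i \<noteq> y ! i} \<le> card {..<n}" by (intro card_mono) auto
  thus ?thesis by (simp add: hamming_dist_def divide_le_eq)
qed

lemma shift_dist_le: "j < n \<Longrightarrow> shift_dist n x y \<le> hamming_dist n y (rotate j x)"
  unfolding shift_dist_def by (intro Min_le) auto

lemma shift_dist_attained:
  assumes "n \<ge> 1"
  obtains j where "j < n" "shift_dist n x y = hamming_dist n y (rotate j x)"
proof -
  have "shift_dist n x y \<in> (\<lambda>j. hamming_dist n y (rotate j x)) ` {..<n}"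
    unfolding shift_dist_def using assms by (intro Min_in) (auto simp: lessThan_empty_iff)
  thus ?thesis using that by (elim imageE) simp
qed

lemma card_agreement:
  assumes "n \<ge> 1" "length x = n"
  shows "real (card {i. i < n \<and> y ! i = x ! ((i + j) mod n)}) = n * (1 - hamming_dist n y (rotate j x))"
proof -
  have rot: "rotate j x ! i = x ! ((i + j) mod n)" if "i < n" for i
    using assms that by (simp add: nth_rotate add.commute[of j])
  let ?A = "{i. i < n \<and> y ! i = x ! ((i + j) mod n)}"
  let ?B = "{i. i < n \<and> y ! i \<noteq> rotate j x ! i}"
  have "card ?A + card ?B = card (?A \<union> ?B)"
    by (intro card_Un_disjoint[symmetric]) (auto simp: rot)
  also have "?A \<union> ?B = {..<n}" by (auto simp: rot)
  finally have "real (card ?A) + real (card ?B) = real n" by (simp flip: of_nat_add)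
  thus ?thesis using assms(1) by (simp add: hamming_dist_def right_diff_distrib)
qed

text \<open>Translation permutes the residues modulo \<open>n\<close>. Hence a uniform offset stays
  uniform after the baby step for a given shift is added.\<close>

lemma card_translate_mod:
  fixes n :: nat
  assumes "n \<ge> 1"
  shows "card {i. i < n \<and> Q ((i + a) mod n)} = card {i. i < n \<and> Q i}"
proof (rule bij_betw_same_card)
  let ?f = "\<lambda>i. (i + a) mod n"
  \<comment> \<open>Adding \<open>n - a mod n\<close> undoes the translation, which yields
    injectivity.\<close>
  have cancel: "(?f z + (n - a mod n)) mod n = z mod n" for z
  proof -
    have "a mod n < n" "a = n * (a div n) + a mod n" using assms by simp_all
    hence "z + a + (n - a mod n) = z + n + n * (a div n)" by linarith
    moreover have "(z + n + n * (a div n)) mod n = z mod n" by simp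
    ultimately show ?thesis by (simp only: mod_add_left_eq)
  qed
  have inj: "inj_on ?f {..<n}"
  proof (rule inj_onI)
    fix x y assume "x \<in> {..<n}" "y \<in> {..<n}" "?f x = ?f y"
    thus "x = y" using cancel[of x] cancel[of y] by simp
  qed
  have surj: "?f ` {..<n} = {..<n}"
    by (rule endo_inj_surj) (use inj assms in auto)
  show "bij_betw ?f {i. i < n \<and> Q (?f i)} {i. i < n \<and> Q i}"
    unfolding bij_betw_def
  proof
    show "inj_on ?f {i. i < n \<and> Q (?f i)}" by (rule inj_on_subset[OF inj]) auto
    have "?f ` {i. i < n \<and> Q (?f i)} = {i \<in> ?f ` {..<n}. Q i}" by auto
    thus "?f ` {i. i < n \<and> Q (?f i)} = {i. i < n \<and> Q i}" by (simp only: surj lessThan_iff)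
  qed
qed

section \<open>Acceptance probability for fixed samples\<close>

lemma offset_pmf_prob_all:
  assumes "l \<le> M"
  shows "measure_pmf.prob (offset_pmf n M) {\<iota>. \<forall>r<l. \<iota> r \<in> C} =
    measure_pmf.prob (pmf_of_set {..<n}) C ^ l"
proof -
  have "{\<iota>. \<forall>r<l. \<iota> r \<in> C} = Pi {..<M} (\<lambda>r. if r < l then C else UNIV)"
    using assms by (auto simp: Pi_def)
  hence "measure_pmf.prob (offset_pmf n M) {\<iota>. \<forall>r<l. \<iota> r \<in> C} =
     (\<Prod>r<M. measure_pmf.prob (pmf_of_set {..<n}) (if r < l then C else UNIV))"
    by (simp add: offset_pmf_def measure_Pi_pmf_Pi)
  also have "\<dots> = (\<Prod>r<l. measure_pmf.prob (pmf_of_set {..<n}) C)"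
    using assms by (intro prod.mono_neutral_cong_right) auto
  finally show ?thesis by simp
qed

text \<open>Union bound over the \<open>n\<close> shifts: each shift of \<open>\<sigma> 0\<close>
  differs from \<open>\<sigma> k\<close> on at least a \<open>\<delta>\<close> fraction of the
  positions, so it survives \<open>m k\<close> independent offsets with probability at most
  \<open>(1 - \<delta>) ^ m k\<close>.\<close>

lemma shift_tester_accept_prob_le:
  assumes n: "n \<ge> 1" "n \<le> g * g" and k: "k \<in> {1..s}" and len: "length (\<sigma> 0) = n"
    and \<delta>: "shift_dist n (\<sigma> 0) (\<sigma> k) \<ge> \<delta>"
  shows "measure_pmf.prob (shift_tester n g m s) {t. accepts \<sigma> t} \<le> n * (1 - \<delta>) ^ m k"
proof -
  \<comment> \<open>The baby step is fixed as a function of the shift before the offsets are drawn,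
    so for each shift the compared positions are translates of independent uniform offsets.\<close>
  have "\<forall>j. \<exists>a. j < n \<longrightarrow> a < g \<and> (\<exists>b\<le>g. b * g = j + a)"
    by (meson giant_step_baby_step n(2))
  from choice[OF this] obtain a where a: "\<And>j. j < n \<Longrightarrow> a j < g \<and> (\<exists>b\<le>g. b * g = j + a j)" by blast
  define M where "M = (\<Sum>k=1..s. m k)"
  have mM: "m k \<le> M" unfolding M_def using k by (intro member_le_sum) auto
  \<comment> \<open>The offsets that fail to refute shift \<open>j\<close>.\<close>
  define C where "C j = {i. \<sigma> k ! ((i + a j) mod n) = \<sigma> 0 ! (((i + a j) mod n + j) mod n)}" for j
  have C: "measure_pmf.prob (pmf_of_set {..<n}) (C j) \<le> 1 - \<delta>" if "j < n" for j
  proof -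
    have "{..<n} \<inter> C j = {i. i < n \<and> \<sigma> k ! ((i + a j) mod n) = \<sigma> 0 ! (((i + a j) mod n + j) mod n)}"
      by (auto simp: C_def)
    moreover have "card \<dots> = card {i. i < n \<and> \<sigma> k ! i = \<sigma> 0 ! ((i + j) mod n)}"
      by (rule card_translate_mod[OF n(1)])
    ultimately have "real (card ({..<n} \<inter> C j)) = n * (1 - hamming_dist n (\<sigma> k) (rotate j (\<sigma> 0)))"
      using card_agreement[OF n(1) len] by simp
    moreover have "measure_pmf.prob (pmf_of_set {..<n}) (C j) = real (card ({..<n} \<inter> C j)) / n"
      using n by (subst measure_pmf_of_set) (auto simp: lessThan_empty_iff)
    ultimately show ?thesis using n \<delta> shift_dist_le[OF that, of "\<sigma> 0" "\<sigma> k"] by simp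
  qed
  let ?p = "offset_pmf n M"
  have "measure_pmf.prob (shift_tester n g m s) {t. accepts \<sigma> t} =
      measure_pmf.prob ?p {\<iota>. accepts \<sigma> (consistency_tree (probes n g m s \<iota>) (all_shifts n s))}"
    by (simp add: shift_tester_def M_def vimage_def)
  also have "\<dots> \<le> measure_pmf.prob ?p (\<Union>j<n. {\<iota>. \<forall>r<m k. \<iota> r \<in> C j})"
  proof (intro measure_pmf.finite_measure_mono subsetI)
    fix \<iota> assume "\<iota> \<in> {\<iota>. accepts \<sigma> (consistency_tree (probes n g m s \<iota>) (all_shifts n s))}"
    then obtain j where "j < n" "\<And>r. r < m k \<Longrightarrow>
        \<sigma> k ! ((\<iota> r + a j) mod n) = \<sigma> 0 ! (((\<iota> r + a j) mod n + j) mod n)"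
      using all_shifts_accepted_agreement[OF _ k a] by blast
    thus "\<iota> \<in> (\<Union>j<n. {\<iota>. \<forall>r<m k. \<iota> r \<in> C j})" by (auto simp: C_def)
  qed auto
  also have "\<dots> \<le> (\<Sum>j<n. measure_pmf.prob ?p {\<iota>. \<forall>r<m k. \<iota> r \<in> C j})"
    by (rule measure_pmf.finite_measure_subadditive_finite) auto
  also have "\<dots> \<le> (\<Sum>j<n. (1 - \<delta>) ^ m k)"
    by (intro sum_mono) (auto simp: offset_pmf_prob_all[OF mM] intro!: power_mono C)
  finally show ?thesis by simp
qed

section \<open>Transport to a distribution of cyclic shifts\<close>

text \<open>The index of a closest shift can be chosen as a function of the string, so its law under
  \<open>P\<close> is an admissible distribution of shift indices.\<close>

lemma distr_dist_Dcyc_of_le: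
  assumes n: "n \<ge> 1" and P: "set_pmf P \<subseteq> bitstrings n" and x: "x \<in> bitstrings n"
  obtains Q where "Q \<in> Dcyc_of n x" "distr_dist n P Q \<le> measure_pmf.expectation P (shift_dist n x)"
proof -
  have "\<forall>y. \<exists>j. j < n \<and> shift_dist n x y = hamming_dist n y (rotate j x)"
    by (intro allI, rule shift_dist_attained[OF n]) blast
  from choice[OF this] obtain j where j: "\<And>y. j y < n" "\<And>y. shift_dist n x y = hamming_dist n y (rotate (j y) x)"
    by blast
  define Q where "Q = map_pmf (\<lambda>i. rotate i x) (map_pmf j P)"
  have "set_pmf (map_pmf j P) \<subseteq> {0..<n}" using j(1) by auto
  hence "Q \<in> Dcyc_of n x" unfolding Dcyc_of_def Q_def by blast
  \<comment> \<open>The plan is deterministic: all mass of \<open>y\<close> goes to its chosen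
    shift.\<close>
  define w where "w y z = (if z = rotate (j y) x then pmf P y else 0)" for y z
  have fin: "finite (bitstrings n)"
    unfolding bitstrings_def using finite_lists_length_eq[of "UNIV :: bool set" n] by simp
  have rot: "rotate (j y) x \<in> bitstrings n" for y using x by (simp add: bitstrings_def)
  have "pmf Q z = (\<Sum>y\<in>bitstrings n. w y z)" for z
  proof -
    have "pmf Q z = measure_pmf.prob P {y. rotate (j y) x = z}"
      by (simp add: Q_def pmf_map vimage_def map_pmf_comp)
    also have "\<dots> = measure_pmf.prob P {y \<in> bitstrings n. rotate (j y) x = z}"
      using P by (intro measure_eq_AE) (auto simp: AE_measure_pmf_iff)
    also have "\<dots> = (\<Sum>y\<in>{y \<in> bitstrings n. rotate (j y) x = z}. pmf P y)"
      using fin by (intro measure_measure_pmf_finite) auto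
    also have "\<dots> = (\<Sum>y\<in>bitstrings n. w y z)"
      unfolding w_def using fin by (intro sum.mono_neutral_cong_left) auto
    finally show ?thesis .
  qed
  hence plan: "transport_plan n P Q w"
    using fin rot by (auto simp: transport_plan_def w_def)
  let ?c = "\<lambda>w. \<Sum>y\<in>bitstrings n. \<Sum>z\<in>bitstrings n. w y z * hamming_dist n y z"
  have "distr_dist n P Q \<le> ?c w" unfolding distr_dist_def
  proof (rule cINF_lower)
    \<comment> \<open>A real infimum is a lower bound only when the costs are bounded below; they
      are nonnegative.\<close>
    show "bdd_below (?c ` {w. transport_plan n P Q w})"
      by (rule bdd_belowI2[of _ 0])
        (auto simp: transport_plan_def hamming_dist_nonneg intro!: sum_nonneg mult_nonneg_nonneg)
  qed (use plan in simp)
  also have "?c w = (\<Sum>y\<in>bitstrings n. shift_dist n x y * pmf P y)"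
  proof (rule sum.cong)
    fix y
    have "(\<Sum>z\<in>bitstrings n. w y z * hamming_dist n y z) =
        (\<Sum>z\<in>bitstrings n. if z = rotate (j y) x then pmf P y * hamming_dist n y z else 0)"
      by (intro sum.cong) (auto simp: w_def)
    thus "(\<Sum>z\<in>bitstrings n. w y z * hamming_dist n y z) = shift_dist n x y * pmf P y"
      using fin rot by (simp add: j(2))
  qed simp
  also have "\<dots> = measure_pmf.expectation P (shift_dist n x)"
    using P fin by (intro integral_measure_pmf_real[symmetric]) auto
  finally show ?thesis by (rule that[OF \<open>Q \<in> Dcyc_of n x\<close>])
qed

text \<open>Since \<open>x\<close> is arbitrary, this applies to whatever string is drawn as
  reference sample.\<close>

lemma far_from_Dcyc_expectation:
  assumes "n \<ge> 1" "set_pmf P \<subseteq> bitstrings n" "far_from n \<epsilon> P (Dcyc n)" "x \<in> bitstrings n"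
  shows "measure_pmf.expectation P (shift_dist n x) > \<epsilon>"
proof -
  obtain Q where "Q \<in> Dcyc_of n x" "distr_dist n P Q \<le> measure_pmf.expectation P (shift_dist n x)"
    using distr_dist_Dcyc_of_le[OF assms(1,2,4)] .
  moreover from this have "distr_dist n P Q > \<epsilon>"
    using assms(3,4) unfolding far_from_def Dcyc_def by blast
  ultimately show ?thesis by linarith
qed

section \<open>Independent samples against increasing thresholds\<close>

text \<open>A conditional bound survives averaging over the first component. It serves to fix the
  reference sample, and later all samples, before bounding a probability.\<close>

lemma prob_pair_pmf_le:
  assumes "\<And>x. x \<in> set_pmf p \<Longrightarrow> measure_pmf.prob q {y. (x, y) \<in> S} \<le> c"
  shows "measure_pmf.prob (pair_pmf p q) S \<le> c"
proof -
  have c: "c \<ge> 0"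
    using assms set_pmf_not_empty[of p] by (meson ex_in_conv measure_nonneg order_trans)
  have "emeasure (pair_pmf p q) S = (\<integral>\<^sup>+x. \<integral>\<^sup>+y. indicator S (x, y) \<partial>q \<partial>p)"
    by (simp add: nn_integral_pair_pmf' flip: nn_integral_indicator)
  also have "\<dots> = (\<integral>\<^sup>+x. emeasure q {y. (x, y) \<in> S} \<partial>p)"
  proof (rule nn_integral_cong)
    fix x
    have "(\<integral>\<^sup>+y. indicator S (x, y) \<partial>q) = (\<integral>\<^sup>+y. indicator {y. (x, y) \<in> S} y \<partial>q)"
      by (intro nn_integral_cong) (simp add: indicator_def)
    thus "(\<integral>\<^sup>+y. indicator S (x, y) \<partial>q) = emeasure q {y. (x, y) \<in> S}" by simp
  qed
  also have "\<dots> \<le> (\<integral>\<^sup>+x. ennreal c \<partial>p)"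
    using assms by (intro nn_integral_mono_AE)
      (auto simp: AE_measure_pmf_iff measure_pmf.emeasure_eq_measure ennreal_leI)
  also have "\<dots> = ennreal c" by (simp add: measure_pmf.emeasure_space_1)
  finally show ?thesis using c by (simp add: measure_pmf.emeasure_eq_measure)
qed

text \<open>With the thresholds \<open>k / s\<close>, the detection probabilities sum to
  the expectation of \<open>\<lfloor>s * f y\<rfloor>\<close>.\<close>

lemma sum_threshold_prob_ge:
  fixes f :: "'a \<Rightarrow> real"
  assumes "s \<ge> 1" and f: "\<And>y. 0 \<le> f y" "\<And>y. f y \<le> 1"
  shows "(\<Sum>k=1..s. measure_pmf.prob P {y. real k / real s \<le> f y}) \<ge> s * measure_pmf.expectation P f - 1"
proof -
  have int: "integrable (measure_pmf P) f"
    using f by (intro measure_pmf.integrable_const_bound[where B = 1]) auto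
  have "s * measure_pmf.expectation P f - 1 = measure_pmf.expectation P (\<lambda>y. s * f y - 1)"
    using int by simp
  also have "\<dots> \<le> measure_pmf.expectation P (\<lambda>y. \<Sum>k=1..s. indicator {y. real k / real s \<le> f y} y)"
  proof (rule integral_mono)
    fix y
    \<comment> \<open>The thresholds met by \<open>f y\<close> are those with
      \<open>k \<le> K\<close>; rounding down loses less than 1.\<close>
    define K where "K = nat \<lfloor>s * f y\<rfloor>"
    have K: "real K \<le> s * f y" "s * f y < real K + 1"
      using f[of y] by (simp_all add: K_def)
    have "real K \<le> s" using K(1) f(2)[of y] mult_left_le[of "f y" "real s"] by linarith
    hence Ks: "K \<le> s" by simp
    have "s * f y - 1 \<le> real (card {1..K})" using K by simp
    also have "\<dots> = (\<Sum>k\<in>{1..K}. 1)" by simp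
    also have "\<dots> \<le> (\<Sum>k\<in>{1..K}. indicator {y. real k / real s \<le> f y} y)"
    proof (rule sum_mono)
      fix k assume "k \<in> {1..K}"
      hence "real k \<le> s * f y" using K(1) by (auto intro: order_trans[of _ "real K"])
      thus "(1::real) \<le> indicator {y. real k / real s \<le> f y} y"
        using assms by (auto simp: field_simps)
    qed
    also have "\<dots> \<le> (\<Sum>k=1..s. indicator {y. real k / real s \<le> f y} y)"
      using Ks by (intro sum_mono2) auto
    finally show "s * f y - 1 \<le> (\<Sum>k=1..s. indicator {y. real k / real s \<le> f y} y)" .
  next
    show "integrable (measure_pmf P) (\<lambda>y. \<Sum>k=1..s. indicator {y. real k / real s \<le> f y} y :: real)"
      by (intro Bochner_Integration.integrable_sum integrable_real_indicator)
        (auto simp: measure_pmf.emeasure_eq_measure)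
  qed (use int in auto)
  also have "\<dots> = (\<Sum>k=1..s. measure_pmf.prob P {y. real k / real s \<le> f y})"
    by (subst Bochner_Integration.integral_sum)
      (auto intro!: integrable_real_indicator simp: measure_pmf.emeasure_eq_measure)
  finally show ?thesis .
qed

text \<open>Independence gives a product of factors \<open>1 - ?p k \<le> exp (- ?p k)\<close>, so
  the detection probabilities add up in the exponent.\<close>

lemma all_below_threshold_prob_le:
  fixes f :: "'a \<Rightarrow> real"
  assumes "s \<ge> 1" and f: "\<And>y. 0 \<le> f y" "\<And>y. f y \<le> 1"
  shows "measure_pmf.prob (Pi_pmf {1..s} d (\<lambda>_. P)) {\<sigma>. \<forall>k\<in>{1..s}. f (\<sigma> k) < real k / real s}
    \<le> exp (1 - s * measure_pmf.expectation P f)"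
proof -
  let ?p = "\<lambda>k. measure_pmf.prob P {y. real k / real s \<le> f y}"
  have "{\<sigma>. \<forall>k\<in>{1..s}. f (\<sigma> k) < real k / real s} = Pi {1..s} (\<lambda>k. {y. f y < real k / real s})"
    by auto
  hence "measure_pmf.prob (Pi_pmf {1..s} d (\<lambda>_. P)) {\<sigma>. \<forall>k\<in>{1..s}. f (\<sigma> k) < real k / real s}
      = (\<Prod>k=1..s. measure_pmf.prob P {y. f y < real k / real s})"
    by (simp add: measure_Pi_pmf_Pi)
  also have "\<dots> = (\<Prod>k=1..s. 1 - ?p k)"
    by (intro prod.cong refl, subst measure_pmf.prob_compl[symmetric])
      (auto intro!: arg_cong2[where f = measure])
  also have "\<dots> \<le> (\<Prod>k=1..s. exp (- ?p k))"
    by (intro prod_mono) (auto intro: order_trans[OF _ exp_ge_add_one_self])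
  also have "\<dots> = exp (- (\<Sum>k=1..s. ?p k))" by (simp add: exp_sum flip: sum_negf)
  also have "\<dots> \<le> exp (1 - s * measure_pmf.expectation P f)"
    using sum_threshold_prob_ge[of s f P, OF assms] by simp
  finally show ?thesis .
qed

section \<open>Completeness and soundness of the tester\<close>

text \<open>Two shifts of one string are shifts of each other, so sample \<open>0\<close> can
  replace the hidden string.\<close>

lemma Dcyc_samples_all_shifts:
  assumes n: "n \<ge> 1" and P: "P \<in> Dcyc n" and \<sigma>: "\<sigma> \<in> set_pmf (Pi_pmf {..<Suc s} d (\<lambda>_. P))"
  shows "all_shifts n s \<sigma>"
proof -
  obtain x where len: "length x = n" and x: "set_pmf P \<subseteq> (\<lambda>j. rotate j x) ` {0..<n}"
    using P by (fastforce simp: Dcyc_def Dcyc_of_def bitstrings_def)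
  have "\<sigma> k \<in> set_pmf P" if "k \<le> s" for k
    using \<sigma> set_Pi_pmf_subset'[of "{..<Suc s}" d "\<lambda>_. P"] that by (force simp: PiE_dflt_def)
  hence shift: "\<exists>j<n. \<sigma> k = rotate j x" if "k \<le> s" for k
    using x that by fastforce
  then obtain i where i: "i < n" "\<sigma> 0 = rotate i x" by blast
  show ?thesis unfolding all_shifts_def
  proof (intro conjI ballI)
    show "length (\<sigma> 0) = n" using i len by simp
    fix k assume "k \<in> {1..s}"
    then obtain j where j: "\<sigma> k = rotate j x" using shift by auto
    \<comment> \<open>Rotating by \<open>n - i\<close> undoes the rotation by \<open>i\<close> that
      produced sample \<open>0\<close>.\<close>
    have "rotate ((j + (n - i)) mod n) (\<sigma> 0) = rotate (j + (n - i)) (\<sigma> 0)"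
      using rotate_conv_mod[of "j + (n - i)" "\<sigma> 0"] i len by simp
    also have "\<dots> = rotate (j + n) x" using i by (simp add: rotate_rotate)
    also have "\<dots> = rotate j x" using rotate_conv_mod[of "j + n" x] rotate_conv_mod[of j x] len by simp
    finally show "\<exists>j<n. \<sigma> k = rotate j (\<sigma> 0)" using j n by (intro exI[of _ "(j + (n - i)) mod n"]) auto
  qed
qed

lemma shift_tester_complete:
  assumes "n \<ge> 1" "P \<in> Dcyc n"
  shows "verdict_prob (Suc s) P (shift_tester n g m s) True = 1"
proof -
  let ?p = "pair_pmf (shift_tester n g m s) (Pi_pmf {..<Suc s} [] (\<lambda>_. P))"
  have "AE w in measure_pmf ?p. w \<in> {(t, \<sigma>). accepts \<sigma> t = True}"
    unfolding AE_measure_pmf_iff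
  proof
    fix w assume "w \<in> set_pmf ?p"
    then obtain t \<sigma> where "w = (t, \<sigma>)" "t \<in> set_pmf (shift_tester n g m s)"
        "\<sigma> \<in> set_pmf (Pi_pmf {..<Suc s} [] (\<lambda>_. P))"
      unfolding set_pair_pmf by blast
    thus "w \<in> {(t, \<sigma>). accepts \<sigma> t = True}"
      using accepts_shift_tester Dcyc_samples_all_shifts[OF assms] by blast
  qed
  thus ?thesis
    unfolding verdict_prob_def by (intro measure_pmf.prob_eq_1[THEN iffD2]) auto
qed

text \<open>The other samples are independent of sample \<open>0\<close>. Once it is fixed, the
  shift distance to it is a fixed function with expectation above \<open>\<epsilon>\<close>.\<close>

lemma reference_samples_below_threshold_prob_le:
  assumes n: "n \<ge> 1" and s: "s \<ge> 1" and P: "set_pmf P \<subseteq> bitstrings n"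
    and far: "far_from n \<epsilon> P (Dcyc n)"
  shows "measure_pmf.prob (Pi_pmf {..<Suc s} d (\<lambda>_. P))
    {\<sigma>. \<forall>k\<in>{1..s}. shift_dist n (\<sigma> 0) (\<sigma> k) < real k / real s} \<le> exp (1 - s * \<epsilon>)"
proof -
  let ?B = "{\<sigma>. \<forall>k\<in>{1..s}. shift_dist n (\<sigma> 0) (\<sigma> k) < real k / real s}"
  have "{..<Suc s} = insert 0 {1..s}" by auto
  hence "measure_pmf.prob (Pi_pmf {..<Suc s} d (\<lambda>_. P)) ?B =
      measure_pmf.prob (pair_pmf P (Pi_pmf {1..s} d (\<lambda>_. P))) {(x, f). f(0 := x) \<in> ?B}"
    by (simp add: Pi_pmf_insert vimage_def case_prod_unfold)
  also have "\<dots> \<le> exp (1 - s * \<epsilon>)"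
  proof (rule prob_pair_pmf_le)
    fix x assume "x \<in> set_pmf P"
    hence x: "x \<in> bitstrings n" using P by blast
    have bnd: "0 \<le> shift_dist n x y" "shift_dist n x y \<le> 1" for y
      using shift_dist_attained[OF n] by (metis hamming_dist_nonneg hamming_dist_le_1)+
    have "{f. (x, f) \<in> {(x, f). f(0 := x) \<in> ?B}} = {f. \<forall>k\<in>{1..s}. shift_dist n x (f k) < real k / real s}"
      by auto
    hence "measure_pmf.prob (Pi_pmf {1..s} d (\<lambda>_. P)) {f. (x, f) \<in> {(x, f). f(0 := x) \<in> ?B}}
        \<le> exp (1 - s * measure_pmf.expectation P (shift_dist n x))"
      using all_below_threshold_prob_le[OF s, of "shift_dist n x"] bnd by simp
    also have "\<dots> \<le> exp (1 - s * \<epsilon>)"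
      using far_from_Dcyc_expectation[OF n P far x] by (simp add: mult_left_mono)
    finally show "measure_pmf.prob (Pi_pmf {1..s} d (\<lambda>_. P)) {f. (x, f) \<in> {(x, f). f(0 := x) \<in> ?B}}
      \<le> exp (1 - s * \<epsilon>)" .
  qed
  finally show ?thesis .
qed

text \<open>False acceptance has two sources: no sample reaches its threshold, or one does and the
  queries fail to refute it. The second is bounded conditionally on the samples.\<close>

lemma shift_tester_sound:
  assumes n: "n \<ge> 1" "n \<le> g * g" and s: "s \<ge> 1" and P: "set_pmf P \<subseteq> bitstrings n"
    and far: "far_from n \<epsilon> P (Dcyc n)"
    and m: "\<And>k. k \<in> {1..s} \<Longrightarrow> n * (1 - real k / real s) ^ m k \<le> \<eta>" and \<eta>: "\<eta> \<ge> 0"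
  shows "verdict_prob (Suc s) P (shift_tester n g m s) False \<ge> 1 - exp (1 - s * \<epsilon>) - \<eta>"
proof -
  let ?A = "shift_tester n g m s"
  let ?\<Sigma> = "Pi_pmf {..<Suc s} [] (\<lambda>_. P)"
  let ?B = "{\<sigma>. \<forall>k\<in>{1..s}. shift_dist n (\<sigma> 0) (\<sigma> k) < real k / real s}"
  \<comment> \<open>Samples come first because \<open>prob_pair_pmf_le\<close> conditions on the
    first component; \<open>verdict_prob\<close> has the opposite order, hence the swap at the
    end.\<close>
  let ?S = "{(\<sigma>, t). \<sigma> \<notin> ?B \<and> accepts \<sigma> t}"
  have len: "length (\<sigma> 0) = n" if "\<sigma> \<in> set_pmf ?\<Sigma>" for \<sigma>
    using that P set_Pi_pmf_subset'[of "{..<Suc s}" "[]" "\<lambda>_. P"]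
    by (force simp: PiE_dflt_def bitstrings_def)
  have S: "measure_pmf.prob (pair_pmf ?\<Sigma> ?A) ?S \<le> \<eta>"
  proof (rule prob_pair_pmf_le)
    fix \<sigma> assume \<sigma>: "\<sigma> \<in> set_pmf ?\<Sigma>"
    show "measure_pmf.prob ?A {t. (\<sigma>, t) \<in> ?S} \<le> \<eta>"
    proof (cases "\<sigma> \<in> ?B")
      case True
      hence "{t. (\<sigma>, t) \<in> ?S} = {}" by blast
      thus ?thesis using \<eta> by (simp only: measure_empty)
    next
      case False
      then obtain k where k: "k \<in> {1..s}" "real k / real s \<le> shift_dist n (\<sigma> 0) (\<sigma> k)"
        by (auto simp: not_less)
      have "measure_pmf.prob ?A {t. (\<sigma>, t) \<in> ?S} \<le> measure_pmf.prob ?A {t. accepts \<sigma> t}"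
        by (intro measure_pmf.finite_measure_mono) auto
      also have "\<dots> \<le> \<eta>"
        using shift_tester_accept_prob_le[where \<sigma> = \<sigma> and m = m, OF n k(1) len[OF \<sigma>] k(2)] m[OF k(1)]
        by linarith
      finally show ?thesis .
    qed
  qed
  have "measure_pmf.prob (pair_pmf ?\<Sigma> ?A) {(\<sigma>, t). accepts \<sigma> t}
      \<le> measure_pmf.prob (pair_pmf ?\<Sigma> ?A) (fst -` ?B \<union> ?S)"
    by (intro measure_pmf.finite_measure_mono) auto
  also have "\<dots> \<le> measure_pmf.prob (pair_pmf ?\<Sigma> ?A) (fst -` ?B) + measure_pmf.prob (pair_pmf ?\<Sigma> ?A) ?S"
    by (intro measure_Un_le) auto
  also have "measure_pmf.prob (pair_pmf ?\<Sigma> ?A) (fst -` ?B) = measure_pmf.prob ?\<Sigma> ?B"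
    by (simp only: measure_map_pmf[symmetric] map_fst_pair_pmf)
  finally have acc: "measure_pmf.prob (pair_pmf ?\<Sigma> ?A) {(\<sigma>, t). accepts \<sigma> t} \<le> exp (1 - s * \<epsilon>) + \<eta>"
    using S reference_samples_below_threshold_prob_le[OF n(1) s P far, of "[]"] by linarith
  have "verdict_prob (Suc s) P ?A False =
      measure_pmf.prob (map_pmf (\<lambda>(\<sigma>, t). (t, \<sigma>)) (pair_pmf ?\<Sigma> ?A)) {(t, \<sigma>). accepts \<sigma> t = False}"
    unfolding verdict_prob_def by (subst pair_commute_pmf) (rule refl)
  also have "\<dots> = measure_pmf.prob (pair_pmf ?\<Sigma> ?A) (UNIV - {(\<sigma>, t). accepts \<sigma> t})"
    unfolding measure_map_pmf by (rule arg_cong2[where f = measure]) auto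
  also have "\<dots> = 1 - measure_pmf.prob (pair_pmf ?\<Sigma> ?A) {(\<sigma>, t). accepts \<sigma> t}"
    using measure_pmf.prob_compl[of "{(\<sigma>, t). accepts \<sigma> t}" "pair_pmf ?\<Sigma> ?A"] by simp
  finally show ?thesis using acc by linarith
qed

section \<open>Choice of parameters and query count\<close>

text \<open>The constant 6 brings the exponent \<open>1 - s * \<epsilon>\<close> in
  \<open>shift_tester_sound\<close> down to at most \<open>- 5\<close>.\<close>

definition sample_count :: "real \<Rightarrow> nat" where
  "sample_count \<epsilon> = nat \<lceil>6 / \<epsilon>\<rceil>"

definition step_size :: "nat \<Rightarrow> nat" where
  "step_size n = nat \<lceil>sqrt (real n)\<rceil>"

text \<open>The summand \<open>ln n\<close> pays for the union bound over \<open>n\<close> shifts,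
  and 5 leaves a failure probability of at most \<open>exp (- 5)\<close>.\<close>

definition rounds :: "nat \<Rightarrow> nat \<Rightarrow> nat \<Rightarrow> nat" where
  "rounds n s k = nat \<lceil>real s / real k * (ln (real n) + 5)\<rceil>"

definition query_count :: "nat \<Rightarrow> real \<Rightarrow> nat" where
  "query_count n \<epsilon> =
     (\<Sum>k=1..sample_count \<epsilon>. rounds n (sample_count \<epsilon>) k) * (2 * step_size n + 1)"

lemma sample_count_bounds:
  fixes \<epsilon> :: real
  assumes "0 < \<epsilon>" "\<epsilon> \<le> 1"
  shows "sample_count \<epsilon> \<ge> 1" "real (sample_count \<epsilon>) * \<epsilon> \<ge> 6" "real (sample_count \<epsilon>) \<le> 7 / \<epsilon>"
proof -
  have ge: "real (sample_count \<epsilon>) \<ge> 6 / \<epsilon>" unfolding sample_count_def by linarith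
  thus "real (sample_count \<epsilon>) * \<epsilon> \<ge> 6" using assms by (simp add: pos_divide_le_eq)
  have "6 / \<epsilon> > 0" using assms by simp
  thus "sample_count \<epsilon> \<ge> 1" using ge by linarith
  have "real (sample_count \<epsilon>) \<le> 6 / \<epsilon> + 1"
    using \<open>6 / \<epsilon> > 0\<close> unfolding sample_count_def by linarith
  also have "\<dots> \<le> 7 / \<epsilon>" using assms by (simp add: field_simps)
  finally show "real (sample_count \<epsilon>) \<le> 7 / \<epsilon>" .
qed

lemma step_size_square_ge: "n \<le> step_size n * step_size n"
proof -
  have "sqrt n \<le> step_size n" unfolding step_size_def by linarith
  hence "sqrt n * sqrt n \<le> real (step_size n) * real (step_size n)" by (intro mult_mono) auto
  hence "real n \<le> real (step_size n * step_size n)" by simp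
  thus ?thesis by (simp only: of_nat_le_iff)
qed

lemma rounds_failure_le:
  assumes "n \<ge> 1" "k \<in> {1..s}"
  shows "n * (1 - real k / real s) ^ rounds n s k \<le> exp (- 5)"
proof -
  have ks: "0 < real k / real s" "real k / real s \<le> 1" using assms by auto
  have "real (rounds n s k) \<ge> real s / real k * (ln (real n) + 5)"
    unfolding rounds_def by linarith
  hence "real k / real s * real (rounds n s k) \<ge> real k / real s * (real s / real k * (ln (real n) + 5))"
    using ks by (intro mult_left_mono) auto
  also have "real k / real s * (real s / real k * (ln (real n) + 5)) = ln (real n) + 5"
    using assms by simp
  finally have r: "ln (real n) + 5 \<le> real k / real s * real (rounds n s k)" .
  have "(1 - real k / real s) ^ rounds n s k \<le> exp (- (real k / real s)) ^ rounds n s k"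
    using ks exp_ge_add_one_self[of "- (real k / real s)"] by (intro power_mono) auto
  also have "\<dots> = exp (- (real k / real s * real (rounds n s k)))"
    by (simp flip: exp_of_nat_mult add: mult.commute)
  also have "\<dots> \<le> exp (- ln (real n) - 5)" using r by simp
  also have "\<dots> = exp (- 5) / n" using assms by (simp add: exp_diff exp_minus field_simps)
  finally show ?thesis using assms by (simp add: field_simps)
qed

text \<open>Rounding up adds at most \<open>1 \<le> s / k\<close>, which turns the 5 into 6 and
  leaves a harmonic sum.\<close>

lemma sum_rounds_le:
  assumes "n \<ge> 1" "s \<ge> 1"
  shows "real (\<Sum>k=1..s. rounds n s k) \<le> (ln (real n) + 6) * (s * (ln (real s) + 1))"
proof -
  have ln: "ln (real n) \<ge> 0" using assms by simp
  have "real (\<Sum>k=1..s. rounds n s k) \<le> (\<Sum>k=1..s. (ln (real n) + 6) * (s * inverse (real k)))"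
    unfolding of_nat_sum
  proof (rule sum_mono)
    fix k assume k: "k \<in> {1..s}"
    have "real s / real k * (ln (real n) + 5) \<ge> 0" using ln by simp
    hence "real (rounds n s k) \<le> real s / real k * (ln (real n) + 5) + 1"
      unfolding rounds_def by linarith
    moreover have "1 \<le> real s / real k" using k by simp
    ultimately have "real (rounds n s k) \<le> real s / real k * (ln (real n) + 5) + real s / real k" by linarith
    also have "real s / real k * (ln (real n) + 5) + real s / real k =
        (ln (real n) + 6) * (s * inverse (real k))"
      by (simp add: divide_inverse algebra_simps)
    finally show "real (rounds n s k) \<le> (ln (real n) + 6) * (s * inverse (real k))" .
  qed
  also have "\<dots> = (ln (real n) + 6) * (s * harm s)"
    by (simp add: harm_def sum_distrib_left)
  also have "\<dots> \<le> (ln (real n) + 6) * (s * (ln (real s) + 1))"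
    \<comment> \<open>\<open>harm s - ln s\<close> decreases from its value 1 at
      \<open>s = 1\<close>.\<close>
    using euler_mascheroni_sequence_decreasing[of 1 s] assms ln
    by (intro mult_left_mono) (auto simp: harm_def)
  finally show ?thesis .
qed

text \<open>The square comes from two logarithms, one from the union bound over shifts and one from
  the harmonic sum, each bounded by \<open>8 * L\<close>. The constant is
  \<open>8 * 7 * 8 * 5\<close>.\<close>

lemma query_count_le:
  fixes n :: nat and \<epsilon> :: real
  assumes n: "n \<ge> 1" and \<epsilon>: "0 < \<epsilon>" "\<epsilon> \<le> 1"
  defines "G \<equiv> sqrt (real n) / \<epsilon>"
  shows "query_count n \<epsilon> \<le> 2240 * (G * ln (2 + G) ^ 2)"
proof -
  define L where "L = ln (2 + G)"
  let ?s = "sample_count \<epsilon>"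
  note s = sample_count_bounds[OF \<epsilon>]
  have n1: "sqrt (real n) \<ge> 1" using n by simp
  have G: "1 / \<epsilon> \<le> G" "sqrt (real n) \<le> G"
    using n1 \<epsilon> by (auto simp: G_def divide_right_mono le_divide_eq mult_left_le)
  hence G1: "G \<ge> 1" using n1 by linarith
  have L1: "L \<ge> 1"
    unfolding L_def using exp_le G1 by (subst ln_ge_iff) auto
  have "ln (sqrt (real n)) \<le> L" unfolding L_def by (rule ln_le_cancel_iff[THEN iffD2]) (use G G1 n1 in linarith)+
  \<comment> \<open>\<open>ln n\<close> is twice \<open>ln (sqrt n)\<close>, hence at most
    \<open>2 * L\<close>, and \<open>6 \<le> 6 * L\<close>.\<close>
  hence lnn: "ln (real n) + 6 \<le> 8 * L" using L1 n by (simp add: ln_sqrt)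
  have "ln (1 / \<epsilon>) \<le> L" unfolding L_def
    by (rule ln_le_cancel_iff[THEN iffD2]) (use \<epsilon> G G1 in simp, (use G G1 in linarith)+)
  moreover have "ln (real ?s) \<le> ln (7 * (1 / \<epsilon>))"
    using s \<epsilon> by (intro ln_le_cancel_iff[THEN iffD2]) auto
  moreover have "ln (7 * (1 / \<epsilon>)) = ln 7 + ln (1 / \<epsilon>)" using \<epsilon> by (subst ln_mult) auto
  moreover have "ln (7::real) \<le> 6" using ln_le_minus_one[of "7::real"] by simp
  ultimately have lns: "ln (real ?s) + 1 \<le> 8 * L" using L1 by linarith
  have lns0: "ln (real ?s) \<ge> 0" using s by simp
  have "real (step_size n) \<le> sqrt (real n) + 1" unfolding step_size_def using n1 by linarith
  \<comment> \<open>From \<open>2 * (sqrt n + 1) + 1\<close> and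
    \<open>1 \<le> sqrt n\<close>.\<close>
  hence g: "2 * real (step_size n) + 1 \<le> 5 * sqrt (real n)" using n1 by linarith
  have "real (\<Sum>k=1..?s. rounds n ?s k) \<le> (ln (real n) + 6) * (?s * (ln (real ?s) + 1))"
    by (rule sum_rounds_le[OF n s(1)])
  also have "\<dots> \<le> (8 * L) * (7 / \<epsilon> * (8 * L))"
    using lnn lns lns0 s \<epsilon> L1 n by (intro mult_mono) auto
  finally have "real (query_count n \<epsilon>) \<le> (8 * L) * (7 / \<epsilon> * (8 * L)) * (5 * sqrt (real n))"
    using g L1 \<epsilon> unfolding query_count_def of_nat_mult by (intro mult_mono) auto
  also have "\<dots> = 2240 * (G * L ^ 2)" by (simp add: G_def power2_eq_square)
  finally show ?thesis unfolding L_def .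
qed

theorem theorem4p3:
  "\<exists>(s :: nat \<Rightarrow> real \<Rightarrow> nat) (q :: nat \<Rightarrow> real \<Rightarrow> nat) (T :: nat \<Rightarrow> real \<Rightarrow> query_tree pmf).
     DoHO_tester Dcyc s q T \<and>
     big_O_bound s (\<lambda>n \<epsilon>. 1 / \<epsilon>) \<and>
     soft_O_bound q (\<lambda>n \<epsilon>. sqrt (real n) / \<epsilon>)"
proof (intro exI conjI)
  \<comment> \<open>The additional sample is the reference.\<close>
  let ?s = "\<lambda>n \<epsilon>. Suc (sample_count \<epsilon>)"
  let ?T = "\<lambda>n \<epsilon>. shift_tester n (step_size n) (rounds n (sample_count \<epsilon>)) (sample_count \<epsilon>)"
  show "DoHO_tester Dcyc ?s query_count ?T" unfolding DoHO_tester_def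
  proof (intro allI impI conjI ballI)
    fix n and \<epsilon> :: real and t
    assume n: "n \<ge> 1" and t: "t \<in> set_pmf (?T n \<epsilon>)"
    show "legal_queries (?s n \<epsilon>) n t" "max_queries t \<le> query_count n \<epsilon>"
      using shift_tester_legal[OF t n] by (simp_all add: query_count_def)
  next
    fix n and \<epsilon> :: real and P
    assume "n \<ge> 1" "P \<in> Dcyc n"
    thus "verdict_prob (?s n \<epsilon>) P (?T n \<epsilon>) True \<ge> 2 / 3" by (simp add: shift_tester_complete)
  next
    fix n and \<epsilon> :: real and P
    assume n: "n \<ge> 1" and \<epsilon>: "0 < \<epsilon>" "\<epsilon> \<le> 1"
      and P: "set_pmf P \<subseteq> bitstrings n" "far_from n \<epsilon> P (Dcyc n)"
    note s = sample_count_bounds[OF \<epsilon>]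
    have "1 - exp (1 - real (sample_count \<epsilon>) * \<epsilon>) - exp (- 5) \<le> verdict_prob (?s n \<epsilon>) P (?T n \<epsilon>) False"
      by (rule shift_tester_sound[OF n step_size_square_ge s(1) P]) (use rounds_failure_le n in auto)
    moreover have "exp (1 - real (sample_count \<epsilon>) * \<epsilon>) \<le> exp (- 5)" using s by simp
    \<comment> \<open>Two errors of at most \<open>1 / 6\<close> each leave
      \<open>2 / 3\<close>.\<close>
    moreover have "exp (- 5 :: real) \<le> 1 / 6"
      using exp_ge_add_one_self[of "5 :: real"] by (simp add: exp_minus field_simps)
    ultimately show "verdict_prob (?s n \<epsilon>) P (?T n \<epsilon>) False \<ge> 2 / 3" by linarith
  qed
  show "big_O_bound ?s (\<lambda>n \<epsilon>. 1 / \<epsilon>)" unfolding big_O_bound_def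
  \<comment> \<open>\<open>7 / \<epsilon>\<close> for the tested samples, and
    \<open>1 \<le> 1 / \<epsilon>\<close> for the reference.\<close>
  proof (intro exI[of _ 8] allI impI)
    fix n :: nat and \<epsilon> :: real assume \<epsilon>: "0 < \<epsilon>" "\<epsilon> \<le> 1"
    have "1 \<le> 1 / \<epsilon>" using \<epsilon> by simp
    thus "real (?s n \<epsilon>) \<le> 8 * (1 / \<epsilon>)" using sample_count_bounds(3)[OF \<epsilon>] by simp
  qed
  show "soft_O_bound query_count (\<lambda>n \<epsilon>. sqrt (real n) / \<epsilon>)"
    unfolding soft_O_bound_def big_O_bound_def using query_count_le by blast
qed

end
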